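(* Let $\Phi$ be an $m\times N$ real matrix with unit-norm columns, with coherence $\mu$, and suppose that $\Phi$ is coherence-invariant; let $\theta=\bar\mu^2$ be its mean square coherence. Let $1\le k<N$, $\epsilon\in(0,1)$, and let $\beta>0$ and $0<a<1$ be any constants. If $$\mu^4\le\frac{(1-a)^2\beta^2}{32\,k\,(\log(2N/\epsilon))^3}\quad\text{and}\quad\theta\le\frac{a\beta}{k\log(2N/\epsilon)},$$ then $\Phi$ has the $(k,\alpha,\epsilon)$-SINC property with $\alpha=\beta/\log(2N/\epsilon)$.
   Context: $\log$ is the natural logarithm. Let $\phi_1,\dots,\phi_N$ be the columns of $\Phi$ and $\mu_{ij}=|\phi_i^T\phi_j|$. The coherence is $\mu=\max_{i\ne j}\mu_{ij}$ and the mean square coherence is $\bar\mu^2=\frac1{N(N-1)}\sum_{i\ne j}\mu_{ij}^2$. $\Phi$ is coherence-invariant if the multiset $\{\mu_{ij}:j\in[N]\setminus\{i\}\}$ does not depend on $i\in[N]=\{1,\dots,N\}$. For $I\subset[N]$, $\Phi_I$ is the submatrix of $\Phi$ with columns indexed by $I$. $\Phi$ is $(k,\alpha,\epsilon)$-SINC if, for $I$ a uniformly random $k$-subset of $[N]$, $\Pr(\max_{i\notin I}\|\Phi_I^T\phi_i\|_2^2\le\alpha)\ge1-\epsilon$. *)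

theory Defs
  imports "HOL-Probability.Probability" "HOL-Library.Multiset"
begin

text \<open>The index set \<open>[N]\<close> of the columns is the finite type \<open>'n\<close>, so \<open>N = CARD('n)\<close>.\<close>

definition pair_coherence :: "real ^ 'n ^ 'm \<Rightarrow> 'n \<Rightarrow> 'n \<Rightarrow> real" where
  "pair_coherence \<Phi> i j = \<bar>column i \<Phi> \<bullet> column j \<Phi>\<bar>"

definition unit_norm_columns :: "real ^ 'n ^ 'm \<Rightarrow> bool" where
  "unit_norm_columns \<Phi> \<longleftrightarrow> (\<forall>i. norm (column i \<Phi>) = 1)"

text \<open>Only meaningful for \<open>N \<ge> 2\<close>; otherwise the maximum is over the empty set.\<close>

definition coherence :: "real ^ 'n ^ 'm \<Rightarrow> real" where
  "coherence \<Phi> = Max {pair_coherence \<Phi> i j | i j. i \<noteq> j}"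

definition mean_square_coherence :: "real ^ 'n ^ 'm \<Rightarrow> real" where
  "mean_square_coherence \<Phi> =
     1 / (real CARD('n) * (real CARD('n) - 1)) *
     (\<Sum>(i, j)\<in>{(i, j). i \<noteq> j}. (pair_coherence \<Phi> i j)\<^sup>2)"

definition coherence_invariant :: "real ^ 'n ^ 'm \<Rightarrow> bool" where
  "coherence_invariant \<Phi> \<longleftrightarrow>
     (\<forall>i i'. image_mset (pair_coherence \<Phi> i) (mset_set (UNIV - {i})) =
             image_mset (pair_coherence \<Phi> i') (mset_set (UNIV - {i'})))"

text \<open>
  The vector \<open>\<Phi>\<^sub>I\<^sup>T \<phi>\<^sub>i\<close> consists of the entries of \<open>\<Phi>\<^sup>T \<phi>\<^sub>i\<close> with index in \<open>I\<close>,
  so its Euclidean norm is the \<open>L2_set\<close> of these entries over \<open>I\<close>.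
\<close>

definition sub_correlation_norm :: "real ^ 'n ^ 'm \<Rightarrow> 'n set \<Rightarrow> 'n \<Rightarrow> real" where
  "sub_correlation_norm \<Phi> I i = L2_set (\<lambda>j. (transpose \<Phi> *v column i \<Phi>) $ j) I"

text \<open>
  Only meaningful for \<open>k < N\<close>: for \<open>k = N\<close> the maximum is over the empty set, and for
  \<open>k > N\<close> there is no \<open>k\<close>-subset to draw.
\<close>

definition SINC :: "real ^ 'n ^ 'm \<Rightarrow> nat \<Rightarrow> real \<Rightarrow> real \<Rightarrow> bool" where
  "SINC \<Phi> k \<alpha> \<epsilon> \<longleftrightarrow>
     measure_pmf.prob (pmf_of_set {I :: 'n set. card I = k})
       {I. Max ((\<lambda>i. (sub_correlation_norm \<Phi> I i)\<^sup>2) ` (UNIV - I)) \<le> \<alpha>} \<ge> 1 - \<epsilon>"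

end

theory Submission
  imports Defs "HOL-Probability.Hoeffding"
begin

text \<open>
  For a fixed column \<open>i\<close>, a \<open>k\<close>-subset \<open>I\<close> with \<open>i \<notin> I\<close> is a sample without replacement
  from the squared coherences \<open>\<mu>\<^sub>i\<^sub>j\<^sup>2 \<in> [0, \<mu>\<^sup>2]\<close>, \<open>j \<noteq> i\<close>, whose mean is \<open>\<theta>\<close> because \<open>\<Phi>\<close> is
  coherence-invariant. Hoeffding's bound for sampling without replacement controls the upper tail
  of \<open>\<Sum>j\<in>I. \<mu>\<^sub>i\<^sub>j\<^sup>2\<close>, and a union bound over \<open>i\<close> finishes the proof. The moment generating
  function of a sample without replacement is a normalised elementary symmetric polynomial in the
  numbers \<open>exp (h x\<^sub>j)\<close>; Maclaurin's inequality bounds it by the one of an independent sample, to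
  which Hoeffding's lemma applies.
\<close>

section \<open>Maclaurin's inequality\<close>

definition elem_sym :: "('a \<Rightarrow> real) \<Rightarrow> 'a set \<Rightarrow> nat \<Rightarrow> real" where
  "elem_sym y A k = (\<Sum>I | I \<subseteq> A \<and> card I = k. prod y I)"

lemma elem_sym_0:
  assumes "finite A"
  shows "elem_sym y A 0 = 1"
proof -
  have "{I. I \<subseteq> A \<and> card I = 0} = {{}}"
    using assms by (auto dest: finite_subset)
  then show ?thesis by (simp add: elem_sym_def)
qed

lemma elem_sym_nonneg:
  assumes "\<And>a. a \<in> A \<Longrightarrow> y a \<ge> 0"
  shows "elem_sym y A k \<ge> 0"
  unfolding elem_sym_def by (intro sum_nonneg prod_nonneg) (use assms in auto)

lemma elem_sym_eq_0:
  assumes "finite A" and "card A < k"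
  shows "elem_sym y A k = 0"
proof -
  have "{I. I \<subseteq> A \<and> card I = k} = {}"
    using card_mono[OF assms(1)] assms(2) by (auto simp: not_le[symmetric])
  then show ?thesis unfolding elem_sym_def by (metis sum.empty)
qed

text \<open>Split the subsets of size \<open>Suc k\<close> by whether they contain \<open>a\<close>;
  removing \<open>a\<close> from those that do leaves the subsets of \<open>A\<close> of size
  \<open>k\<close>.\<close>

lemma elem_sym_insert:
  assumes "finite A" and "a \<notin> A"
  shows "elem_sym y (insert a A) (Suc k) = elem_sym y A (Suc k) + y a * elem_sym y A k"
proof -
  let ?S = "\<lambda>k. {I. I \<subseteq> A \<and> card I = k}"
  have fin: "finite I" if "I \<subseteq> A" for I
    using assms(1) that finite_subset by blast
  have split: "{I. I \<subseteq> insert a A \<and> card I = Suc k} = ?S (Suc k) \<union> insert a ` ?S k"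
  proof (intro equalityI subsetI)
    fix I assume I: "I \<in> {I. I \<subseteq> insert a A \<and> card I = Suc k}"
    show "I \<in> ?S (Suc k) \<union> insert a ` ?S k"
    proof (cases "a \<in> I")
      case True
      then have "I = insert a (I - {a})" "I - {a} \<in> ?S k"
        using I by auto
      then show ?thesis by blast
    qed (use I in auto)
  next
    fix I assume "I \<in> ?S (Suc k) \<union> insert a ` ?S k"
    then show "I \<in> {I. I \<subseteq> insert a A \<and> card I = Suc k}"
      using assms fin by (auto simp: card_insert_if)
  qed
  have inj: "inj_on (insert a) (?S k)"
    using assms(2) by (auto simp: inj_on_def)
  have "elem_sym y (insert a A) (Suc k)
      = elem_sym y A (Suc k) + (\<Sum>I\<in>insert a ` ?S k. prod y I)"
    unfolding elem_sym_def split
    by (rule sum.union_disjoint) (use assms in auto)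
  also have "(\<Sum>I\<in>insert a ` ?S k. prod y I) = (\<Sum>I\<in>?S k. prod y (insert a I))"
    using inj by (simp add: sum.reindex)
  also have "\<dots> = (\<Sum>I\<in>?S k. y a * prod y I)"
    using assms fin by (intro sum.cong refl prod.insert) auto
  also have "\<dots> = y a * elem_sym y A k"
    by (simp add: elem_sym_def sum_distrib_left)
  finally show ?thesis .
qed

text \<open>Double counting: the product over a \<open>k\<close>-subset \<open>I\<close> occurs once
  for each \<open>a\<close> in \<open>A\<close> outside \<open>I\<close>.\<close>

lemma sum_elem_sym_remove:
  assumes "finite A"
  shows "(\<Sum>a\<in>A. elem_sym y (A - {a}) k) = (real (card A) - real k) * elem_sym y A k"
proof -
  let ?S = "{I. I \<subseteq> A \<and> card I = k}"
  have "(\<Sum>a\<in>A. elem_sym y (A - {a}) k) = (\<Sum>a\<in>A. \<Sum>I | I \<in> ?S \<and> a \<notin> I. prod y I)"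
    unfolding elem_sym_def by (intro sum.cong refl arg_cong2[where f = sum]) auto
  also have "\<dots> = (\<Sum>I\<in>?S. \<Sum>a | a \<in> A \<and> a \<notin> I. prod y I)"
    by (rule sum.swap_restrict) (use assms in auto)
  also have "\<dots> = (\<Sum>I\<in>?S. (real (card A) - real k) * prod y I)"
  proof (intro sum.cong refl)
    fix I assume I: "I \<in> ?S"
    have "card {a \<in> A. a \<notin> I} = card A - card I"
      using I assms finite_subset by (subst card_Diff_subset[symmetric]) (auto simp: set_diff_eq)
    moreover have "card I \<le> card A"
      using I assms card_mono by auto
    ultimately show "(\<Sum>a | a \<in> A \<and> a \<notin> I. prod y I) = (real (card A) - real k) * prod y I"
      using I by (simp add: of_nat_diff)
  qed
  finally show ?thesis by (simp add: elem_sym_def sum_distrib_left)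
qed

text \<open>A term on the left is the part of \<open>elem_sym y A (Suc k)\<close> coming from sets
  that contain \<open>a\<close>, so each product is counted once per element of its set.\<close>

lemma sum_times_elem_sym_remove:
  assumes "finite A"
  shows "(\<Sum>a\<in>A. y a * elem_sym y (A - {a}) k) = real (Suc k) * elem_sym y A (Suc k)"
proof -
  have "(\<Sum>a\<in>A. y a * elem_sym y (A - {a}) k)
      = (\<Sum>a\<in>A. elem_sym y A (Suc k) - elem_sym y (A - {a}) (Suc k))"
  proof (intro sum.cong refl)
    fix a assume "a \<in> A"
    then show "y a * elem_sym y (A - {a}) k = elem_sym y A (Suc k) - elem_sym y (A - {a}) (Suc k)"
      using elem_sym_insert[of "A - {a}" a y k] assms by (simp add: insert_absorb)
  qed
  also have "\<dots> = real (Suc k) * elem_sym y A (Suc k)"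
    unfolding sum_subtractf sum_elem_sym_remove[OF assms] by (simp add: algebra_simps)
  finally show ?thesis .
qed

text \<open>Summed over all pairs, the nonpositive products in the hypothesis give twice the
  difference of the two sides.\<close>

lemma chebyshev_sum_opposite:
  fixes f g :: "'a \<Rightarrow> real"
  assumes "\<And>a b. a \<in> A \<Longrightarrow> b \<in> A \<Longrightarrow> (f a - f b) * (g a - g b) \<le> 0"
  shows "real (card A) * (\<Sum>a\<in>A. f a * g a) \<le> (\<Sum>a\<in>A. f a) * (\<Sum>a\<in>A. g a)"
proof -
  have "(\<Sum>a\<in>A. \<Sum>b\<in>A. (f a - f b) * (g a - g b)) \<le> 0"
    using assms by (intro sum_nonpos)
  also have "(\<Sum>a\<in>A. \<Sum>b\<in>A. (f a - f b) * (g a - g b))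
      = (\<Sum>a\<in>A. \<Sum>b\<in>A. f a * g a + f b * g b) - (\<Sum>a\<in>A. \<Sum>b\<in>A. f a * g b)
        - (\<Sum>a\<in>A. \<Sum>b\<in>A. f b * g a)"
    unfolding sum_subtractf[symmetric] by (intro sum.cong refl) (simp add: algebra_simps)
  also have "(\<Sum>a\<in>A. \<Sum>b\<in>A. f b * g a) = (\<Sum>a\<in>A. \<Sum>b\<in>A. f a * g b)"
    by (rule sum.swap)
  also have "(\<Sum>a\<in>A. \<Sum>b\<in>A. f a * g a + f b * g b) = 2 * (real (card A) * (\<Sum>a\<in>A. f a * g a))"
    by (simp add: sum.distrib sum_distrib_left)
  finally show ?thesis
    unfolding sum_product by linarith
qed

text \<open>
  The weights \<open>e\<^sub>k(A - {a})\<close> decrease as \<open>y a\<close> grows, so Chebyshev's sum inequality applies to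
  \<open>\<Sum>a. y a e\<^sub>k(A - {a})\<close>.
\<close>

lemma elem_sym_Suc_le:
  assumes "finite A" and nonneg: "\<And>a. a \<in> A \<Longrightarrow> y a \<ge> 0"
  shows "real (card A) * (real (Suc k) * elem_sym y A (Suc k))
      \<le> sum y A * ((real (card A) - real k) * elem_sym y A k)"
proof -
  have "(y a - y b) * (elem_sym y (A - {a}) k - elem_sym y (A - {b}) k) \<le> 0"
    if ab: "a \<in> A" "b \<in> A" for a b
  proof (cases "a = b \<or> k = 0")
    case True
    then show ?thesis using assms(1) by (auto simp: elem_sym_0)
  next
    case False
    then obtain k' where k: "k = Suc k'" and "a \<noteq> b" by (metis not0_implies_Suc)
    \<comment> \<open>Expanding both polynomials over the common part \<open>?B\<close> leaves the
      difference \<open>(y b - y a) * elem_sym y ?B k'\<close>, whose sign is opposite to that of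
      \<open>y a - y b\<close>.\<close>
    let ?B = "A - {a} - {b}"
    have a: "elem_sym y (A - {a}) k = elem_sym y ?B k + y b * elem_sym y ?B k'"
      using elem_sym_insert[of ?B b y k'] assms(1) ab \<open>a \<noteq> b\<close> k by (simp add: insert_absorb)
    have "insert a ?B = A - {b}"
      using ab \<open>a \<noteq> b\<close> by auto
    then have b: "elem_sym y (A - {b}) k = elem_sym y ?B k + y a * elem_sym y ?B k'"
      using elem_sym_insert[of ?B a y k'] assms(1) k by simp
    have "(y a - y b) * (elem_sym y (A - {a}) k - elem_sym y (A - {b}) k)
        = - ((y a - y b)\<^sup>2 * elem_sym y ?B k')"
      unfolding a b by (simp add: power2_eq_square algebra_simps)
    then show ?thesis
      using elem_sym_nonneg[of ?B y k'] nonneg by simp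
  qed
  from chebyshev_sum_opposite[of A y "\<lambda>a. elem_sym y (A - {a}) k", OF this]
  show ?thesis
    unfolding sum_elem_sym_remove[OF assms(1)] sum_times_elem_sym_remove[OF assms(1)] .
qed

text \<open>By \<open>elem_sym_Suc_le\<close>, the average of \<open>prod y I\<close> over the
  \<open>k\<close>-subsets grows by at most a factor of the mean of \<open>y\<close> when
  \<open>k\<close> increases by one; the absorption identity for binomials turns this into the
  induction step.\<close>

lemma maclaurin_elem_sym_le:
  assumes fin: "finite A" and "A \<noteq> {}" and nonneg: "\<And>a. a \<in> A \<Longrightarrow> y a \<ge> 0"
  shows "elem_sym y A k \<le> real (card A choose k) * (sum y A / real (card A)) ^ k"
proof (induction k)
  case 0
  show ?case using fin by (simp add: elem_sym_0)
next
  case (Suc k)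
  let ?n = "card A"
  have n: "real ?n > 0" using assms(1,2) by (simp add: card_gt_0_iff)
  have s: "sum y A \<ge> 0" using nonneg by (rule sum_nonneg)
  show ?case
  proof (cases "k < ?n")
    case False
    then show ?thesis using elem_sym_eq_0[OF fin, of "Suc k" y] by (simp add: binomial_eq_0)
  next
    case True
    have "(?n - k) * (?n choose k) = Suc k * (?n choose Suc k)"
      using True binomial_absorption[of k ?n] binomial_absorb_comp[of ?n k] by simp
    then have binom: "(real ?n - real k) * real (?n choose k) = real (Suc k) * real (?n choose Suc k)"
      using True by (metis of_nat_diff of_nat_mult less_imp_le)
    have "real ?n * (real (Suc k) * elem_sym y A (Suc k))
        \<le> sum y A * ((real ?n - real k) * elem_sym y A k)"
      by (rule elem_sym_Suc_le[OF fin nonneg])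
    also have "\<dots> \<le> sum y A * ((real ?n - real k)
        * (real (?n choose k) * (sum y A / real ?n) ^ k))"
      using True s Suc.IH by (intro mult_left_mono) auto
    also have "\<dots> = sum y A * (real (Suc k) * real (?n choose Suc k)) * (sum y A / real ?n) ^ k"
      unfolding binom[symmetric] by simp
    also have "\<dots> = real ?n * (real (Suc k)
        * (real (?n choose Suc k) * (sum y A / real ?n) ^ Suc k))"
      using n by simp
    finally show ?thesis using n by (simp del: of_nat_Suc power_Suc)
  qed
qed

section \<open>Hoeffding's inequality for sampling without replacement\<close>

text \<open>This is Hoeffding's lemma for one uniform draw from \<open>A\<close>: centring at
  \<open>m\<close> keeps the width \<open>u - l\<close>, and the factor \<open>exp (h * m)\<close>
  is restored at the end.\<close>

lemma mean_exp_le: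
  fixes x :: "'a \<Rightarrow> real"
  assumes "finite A" and "A \<noteq> {}" and "\<And>a. a \<in> A \<Longrightarrow> x a \<in> {l..u}" and "h > 0"
  defines "m \<equiv> sum x A / real (card A)"
  shows "(\<Sum>a\<in>A. exp (h * x a)) / real (card A) \<le> exp (h * m + h\<^sup>2 * (u - l)\<^sup>2 / 8)"
proof -
  let ?p = "pmf_of_set A"
  have E: "measure_pmf.expectation ?p f = sum f A / real (card A)" for f :: "'a \<Rightarrow> real"
    using assms(1,2) by (rule integral_pmf_of_set[rotated])
  interpret interval_bounded_random_variable ?p "\<lambda>a. x a - m" "l - m" "u - m"
    by unfold_locales (use assms in \<open>auto simp: AE_measure_pmf_iff\<close>)
  have "measure_pmf.expectation ?p (\<lambda>a. x a - m) = 0"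
    unfolding E using assms(1,2) by (simp add: m_def sum_subtractf)
  then have "(\<integral>\<^sup>+a. exp (h * (x a - m)) \<partial>?p) \<le> ennreal (exp (h\<^sup>2 * (u - l)\<^sup>2 / 8))"
    using Hoeffdings_lemma_nn_integral_0[OF \<open>h > 0\<close>] by simp
  also have "(\<integral>\<^sup>+a. exp (h * (x a - m)) \<partial>?p)
      = ennreal (measure_pmf.expectation ?p (\<lambda>a. exp (h * (x a - m))))"
    by (intro nn_integral_eq_integral integrable_measure_pmf_finite) (use assms(1,2) in auto)
  finally have "(\<Sum>a\<in>A. exp (h * (x a - m))) / real (card A) \<le> exp (h\<^sup>2 * (u - l)\<^sup>2 / 8)"
    unfolding E by simp
  then have "exp (h * m) * ((\<Sum>a\<in>A. exp (h * (x a - m))) / real (card A))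
      \<le> exp (h * m) * exp (h\<^sup>2 * (u - l)\<^sup>2 / 8)"
    by (intro mult_left_mono) auto
  then show ?thesis
    by (simp add: sum_distrib_left exp_add[symmetric] right_diff_distrib)
qed

text \<open>Chernoff's method, stated as a count of subsets so that the union bound can add
  cardinalities.\<close>

lemma hoeffding_without_replacement:
  fixes x :: "'a \<Rightarrow> real"
  assumes fin: "finite A" and ne: "A \<noteq> {}" and bounds: "\<And>a. a \<in> A \<Longrightarrow> x a \<in> {l..u}" and "t \<ge> 0"
  shows "real (card {I. I \<subseteq> A \<and> card I = k \<and> sum x I \<ge> real k * (sum x A / real (card A)) + t})
      \<le> real (card A choose k) * exp (- (2 * t\<^sup>2 / (real k * (u - l)\<^sup>2)))"
    (is "real (card ?B) \<le> _")
\<comment> \<open>In these cases the exponent is 0, partly because division by zero yields 0, and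
  the bound is the number of all \<open>k\<close>-subsets.\<close>
proof (cases "t = 0 \<or> k = 0 \<or> u = l")
  case True
  have "card ?B \<le> card {I. I \<subseteq> A \<and> card I = k}"
    by (rule card_mono) (use fin in auto)
  also have "\<dots> = card A choose k"
    using fin by (rule n_subsets)
  finally show ?thesis using True by auto
next
  case False
  define m where "m = sum x A / real (card A)"
  define v where "v = real k * (u - l)\<^sup>2"
  \<comment> \<open>This \<open>h\<close> minimises \<open>h\<^sup>2 * v / 8 - h * t\<close>, with
    minimum \<open>- (2 * t\<^sup>2 / v)\<close>.\<close>
  define h where "h = 4 * t / v"
  have v: "v > 0" using False by (simp add: v_def)
  have h: "h > 0" using False v \<open>t \<ge> 0\<close> by (simp add: h_def)
  have "real (card ?B) * exp (h * (real k * m + t)) = (\<Sum>I\<in>?B. exp (h * (real k * m + t)))"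
    by simp
  also have "\<dots> \<le> (\<Sum>I\<in>?B. exp (h * sum x I))"
    using h by (intro sum_mono) (auto simp: m_def)
  also have "\<dots> \<le> (\<Sum>I | I \<subseteq> A \<and> card I = k. exp (h * sum x I))"
    by (rule sum_mono2) (use fin in auto)
  also have "\<dots> = elem_sym (\<lambda>a. exp (h * x a)) A k"
    unfolding elem_sym_def using fin
    by (intro sum.cong refl) (auto simp: sum_distrib_left exp_sum finite_subset)
  also have "\<dots> \<le> real (card A choose k) * ((\<Sum>a\<in>A. exp (h * x a)) / real (card A)) ^ k"
    by (rule maclaurin_elem_sym_le[OF fin ne]) simp
  also have "\<dots> \<le> real (card A choose k) * exp (h * m + h\<^sup>2 * (u - l)\<^sup>2 / 8) ^ k"
    using mean_exp_le[OF fin ne bounds h]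
    by (intro mult_left_mono power_mono) (auto simp: m_def intro!: divide_nonneg_nonneg sum_nonneg)
  also have "\<dots> = real (card A choose k) * exp (real k * (h * m) + h\<^sup>2 * v / 8)"
    by (simp add: exp_of_nat_mult[symmetric] v_def algebra_simps)
  finally have "real (card ?B)
      \<le> real (card A choose k) * exp (real k * (h * m) + h\<^sup>2 * v / 8) / exp (h * (real k * m + t))"
    by (simp add: pos_le_divide_eq)
  also have "\<dots> = real (card A choose k) * exp (h\<^sup>2 * v / 8 - h * t)"
    by (simp add: exp_diff exp_add distrib_left mult.left_commute)
  also have "h\<^sup>2 * v / 8 - h * t = - (2 * t\<^sup>2 / v)"
    using v by (simp add: h_def field_simps power2_eq_square)
  finally show ?thesis by (simp add: v_def)
qed

section \<open>Coherence and the union bound\<close>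

lemma sub_correlation_norm_power2:
  "(sub_correlation_norm \<Phi> I i)\<^sup>2 = (\<Sum>j\<in>I. (pair_coherence \<Phi> i j)\<^sup>2)"
proof -
  have "(transpose \<Phi> *v column i \<Phi>) $ j = column i \<Phi> \<bullet> column j \<Phi>" for j
    by (simp add: matrix_vector_mult_def transpose_def inner_vec_def column_def mult.commute)
  then show ?thesis
    by (simp add: sub_correlation_norm_def L2_set_def pair_coherence_def sum_nonneg)
qed

lemma pair_coherence_le_coherence:
  assumes "i \<noteq> j"
  shows "pair_coherence \<Phi> i j \<le> coherence \<Phi>"
proof -
  have "{pair_coherence \<Phi> i j |i j. i \<noteq> j} \<subseteq> (\<lambda>(i, j). pair_coherence \<Phi> i j) ` UNIV"
    by auto
  then have "finite {pair_coherence \<Phi> i j |i j. i \<noteq> j}"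
    by (rule finite_subset) simp
  then show ?thesis
    unfolding coherence_def using assms by (intro Max_ge) auto
qed

text \<open>Equal multisets have equal sums of squares, so every row contributes the same amount to
  the double sum.\<close>

lemma coherence_invariant_mean:
  fixes \<Phi> :: "real ^ 'n ^ 'm"
  assumes "coherence_invariant \<Phi>"
  shows "(\<Sum>j\<in>UNIV - {i}. (pair_coherence \<Phi> i j)\<^sup>2) / real (card (UNIV - {i}))
      = mean_square_coherence \<Phi>"
proof -
  define c where "c = (\<lambda>i. \<Sum>j\<in>UNIV - {i}. (pair_coherence \<Phi> i j)\<^sup>2)"
  have "c i' = sum_mset (image_mset (\<lambda>v. v\<^sup>2)
      (image_mset (pair_coherence \<Phi> i') (mset_set (UNIV - {i'}))))" for i'
    by (simp add: c_def sum_unfold_sum_mset image_mset.compositionality comp_def)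
  then have c: "c i' = c i" for i'
    using assms unfolding coherence_invariant_def by metis
  have "(\<Sum>(i, j)\<in>{(i, j). i \<noteq> j}. (pair_coherence \<Phi> i j)\<^sup>2)
      = (\<Sum>(i, j)\<in>Sigma UNIV (\<lambda>i. UNIV - {i}). (pair_coherence \<Phi> i j)\<^sup>2)"
    by (intro sum.cong) auto
  also have "\<dots> = sum c UNIV"
    unfolding c_def by (rule sum.Sigma[symmetric]) auto
  also have "\<dots> = (\<Sum>i'\<in>(UNIV :: 'n set). c i)"
    by (intro sum.cong refl c)
  finally show ?thesis
    by (simp add: mean_square_coherence_def c_def of_nat_diff Suc_leI)
qed

text \<open>Union bound by counting: every failing \<open>k\<close>-subset lies in some
  \<open>B i\<close>, and each \<open>B i\<close> holds at most a fraction
  \<open>\<epsilon> / N\<close> of all \<open>k\<close>-subsets.\<close>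

lemma prob_pmf_of_subsets_ge:
  fixes B :: "'n :: finite \<Rightarrow> 'n set set"
  assumes "k \<le> CARD('n)"
    and cover: "\<And>I. card I = k \<Longrightarrow> I \<notin> G \<Longrightarrow> \<exists>i. I \<in> B i"
    and bound: "\<And>i. real (card (B i)) \<le> real (CARD('n) choose k) * (\<epsilon> / real CARD('n))"
  shows "measure_pmf.prob (pmf_of_set {I :: 'n set. card I = k}) G \<ge> 1 - \<epsilon>"
proof -
  let ?S = "{I :: 'n set. card I = k}"
  have cardS: "card ?S = CARD('n) choose k"
    using n_subsets[of "UNIV :: 'n set" k] by simp
  then have pos: "real (card ?S) > 0" using assms(1) by simp
  then have ne: "?S \<noteq> {}" by force
  have "card (?S - G) \<le> card (\<Union>i. B i)"
    using cover by (intro card_mono) auto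
  also have "\<dots> \<le> (\<Sum>i\<in>UNIV. card (B i))"
    by (rule card_UN_le) simp
  finally have "real (card (?S - G)) \<le> (\<Sum>i\<in>UNIV. real (card (B i)))"
    by (metis of_nat_le_iff of_nat_sum)
  also have "\<dots> \<le> (\<Sum>i\<in>(UNIV :: 'n set). real (card ?S) * (\<epsilon> / real CARD('n)))"
    unfolding cardS by (intro sum_mono bound)
  also have "\<dots> = real (card ?S) * \<epsilon>"
    by simp
  finally have bad: "real (card (?S - G)) \<le> real (card ?S) * \<epsilon>" .
  have "card ?S = card (?S \<inter> G) + card (?S - G)"
    by (subst card_Un_disjoint[symmetric]) (auto intro!: arg_cong[where f = card])
  then have "real (card ?S) = real (card (?S \<inter> G)) + real (card (?S - G))"
    by (metis of_nat_add)
  then have "real (card (?S \<inter> G)) \<ge> (1 - \<epsilon>) * real (card ?S)"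
    using bad by (simp add: algebra_simps)
  then show ?thesis
    using pos ne by (subst measure_pmf_of_set) (auto simp: pos_le_divide_eq)
qed

theorem theorem4p1:
  fixes \<Phi> :: "real ^ 'n ^ 'm" and k :: nat and \<epsilon> \<beta> a :: real
  assumes "unit_norm_columns \<Phi>"
    and "coherence_invariant \<Phi>"
    and "1 \<le> k" and "k < CARD('n)"
    and "0 < \<epsilon>" and "\<epsilon> < 1"
    and "\<beta> > 0"
    and "0 < a" and "a < 1"
    and "coherence \<Phi> ^ 4 \<le>
           (1 - a)\<^sup>2 * \<beta>\<^sup>2 / (32 * real k * ln (2 * real CARD('n) / \<epsilon>) ^ 3)"
    and "mean_square_coherence \<Phi> \<le> a * \<beta> / (real k * ln (2 * real CARD('n) / \<epsilon>))"
  shows "SINC \<Phi> k (\<beta> / ln (2 * real CARD('n) / \<epsilon>)) \<epsilon>"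
proof -
  define L where "L = ln (2 * real CARD('n) / \<epsilon>)"
  \<comment> \<open>The slack between the threshold \<open>\<beta> / L\<close> and
    \<open>a * \<beta> / L\<close>, which bounds the mean of the sampled sum.\<close>
  define t where "t = (1 - a) * \<beta> / L"
  define x where "x = (\<lambda>i j. (pair_coherence \<Phi> i j)\<^sup>2)"
  let ?\<mu> = "coherence \<Phi>"
  define B where "B = (\<lambda>i. {I. I \<subseteq> UNIV - {i} \<and> card I = k \<and> \<beta> / L \<le> sum (x i) I})"
  have N: "real CARD('n) \<ge> 2" using assms(3,4) by linarith
  have "2 * real CARD('n) / \<epsilon> > 1"
    using N assms(5,6) by (simp add: field_simps)
  then have L: "L > 0" by (simp add: L_def)
  have t: "t > 0" using assms L by (simp add: t_def)
  have x: "x i j \<in> {0..?\<mu>\<^sup>2}" if "j \<in> UNIV - {i}" for i j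
    using power_mono[OF pair_coherence_le_coherence[of i j \<Phi>], of 2] that
    by (auto simp: x_def pair_coherence_def)
  have tail: "real (card (B i)) \<le> real (CARD('n) choose k) * (\<epsilon> / real CARD('n))" for i
  \<comment> \<open>Zero coherence would make the Hoeffding exponent degenerate to 0; but then all
    sums vanish and none reaches the positive threshold.\<close>
  proof (cases "?\<mu> = 0")
    case True
    have "sum (x i) I = 0" if "I \<subseteq> UNIV - {i}" for I
      using x[of _ i] that True by (intro sum.neutral) force
    moreover have "\<not> \<beta> / L \<le> 0"
      using L assms(7) by (simp add: not_le)
    ultimately have "B i = {}"
      unfolding B_def by (metis (mono_tags, lifting) Collect_empty_eq)
    then show ?thesis using assms(5) by simp
  next
    case False
    let ?A = "UNIV - {i}"
    have "real k * (sum (x i) ?A / real (card ?A)) \<le> real k * (a * \<beta> / (real k * L))"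
      using assms(11) unfolding x_def L_def coherence_invariant_mean[OF assms(2)]
      by (intro mult_left_mono) auto
    also have "\<dots> = a * \<beta> / L" using assms(3) by simp
    finally have "real k * (sum (x i) ?A / real (card ?A)) + t \<le> \<beta> / L"
      by (simp add: t_def diff_divide_distrib left_diff_distrib)
    then have "card (B i) \<le> card {I. I \<subseteq> ?A \<and> card I = k
        \<and> sum (x i) I \<ge> real k * (sum (x i) ?A / real (card ?A)) + t}"
      unfolding B_def by (intro card_mono) auto
    \<comment> \<open>The samples are squares in \<open>{0..?\<mu>\<^sup>2}\<close>, so the squared
      width is the fourth power of the coherence, as in the hypothesis.\<close>
    also have "real \<dots> \<le> real (card ?A choose k) * exp (- (2 * t\<^sup>2 / (real k * (?\<mu>\<^sup>2 - 0)\<^sup>2)))"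
    proof (rule hoeffding_without_replacement)
      have "card ?A > 0" using assms(3,4) by simp
      then show "?A \<noteq> {}" by force
    qed (use x t in auto)
    also have "\<dots> \<le> real (CARD('n) choose k) * exp (- L)"
    proof (intro mult_mono)
      have "card ?A choose k \<le> CARD('n) choose k"
        by (rule binomial_right_mono) simp
      then show "real (card ?A choose k) \<le> real (CARD('n) choose k)" by simp
      have "real k * ?\<mu> ^ 4 * (32 * L ^ 3) \<le> (1 - a)\<^sup>2 * \<beta>\<^sup>2"
        using assms(3,10) L unfolding L_def[symmetric] by (simp add: field_simps)
      also have "\<dots> = t\<^sup>2 * L\<^sup>2"
        using L by (simp add: t_def power_divide power_mult_distrib)
      finally have "32 * L * (real k * ?\<mu> ^ 4) * L\<^sup>2 \<le> t\<^sup>2 * L\<^sup>2"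
        by (simp add: power2_eq_square power3_eq_cube mult_ac)
      then have "32 * L * (real k * ?\<mu> ^ 4) \<le> t\<^sup>2"
        using L by simp
      moreover have "real k * ?\<mu> ^ 4 > 0"
        using False assms(3) by simp
      \<comment> \<open>Positivity lets \<open>linarith\<close> weaken the factor 32 to the 1/2 that
        the exponent requires.\<close>
      moreover from this have "L * (real k * ?\<mu> ^ 4) > 0"
        using L by (rule mult_pos_pos[rotated])
      ultimately have "L \<le> 2 * t\<^sup>2 / (real k * ?\<mu> ^ 4)"
        by (subst pos_le_divide_eq) linarith+
      then show "exp (- (2 * t\<^sup>2 / (real k * (?\<mu>\<^sup>2 - 0)\<^sup>2))) \<le> exp (- L)"
        by simp
    qed auto
    \<comment> \<open>The choice of \<open>L\<close> makes each tail half of the share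
      \<open>\<epsilon> / N\<close> allowed to one column.\<close>
    also have "exp (- L) = \<epsilon> / (2 * real CARD('n))"
      using N assms(5) by (simp add: L_def exp_minus)
    also have "real (CARD('n) choose k) * (\<epsilon> / (2 * real CARD('n)))
        \<le> real (CARD('n) choose k) * (\<epsilon> / real CARD('n))"
      using N assms(5) by (intro mult_left_mono divide_left_mono) auto
    finally show ?thesis by simp
  qed
  show ?thesis
    unfolding SINC_def L_def[symmetric]
  proof (rule prob_pmf_of_subsets_ge[where B = B])
    fix I :: "'n set"
    assume I: "card I = k"
      "I \<notin> {I. Max ((\<lambda>i. (sub_correlation_norm \<Phi> I i)\<^sup>2) ` (UNIV - I)) \<le> \<beta> / L}"
    \<comment> \<open>Since \<open>k < N\<close>, the maximum is over a nonempty set, so exceeding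
      the threshold yields a witness column outside \<open>I\<close>.\<close>
    have "I \<noteq> UNIV" using I(1) assms(4) by auto
    then have "UNIV - I \<noteq> {}" by blast
    then obtain i where "i \<notin> I" "\<beta> / L < sum (x i) I"
      using I(2) by (auto simp: sub_correlation_norm_power2 x_def not_le)
    then show "\<exists>i. I \<in> B i"
      using I(1) by (auto simp: B_def intro: less_imp_le)
  qed (use assms(4) tail in auto)
qed

end
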